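(* Let $K$ be a totally real extension of $\mathbb{Q}$. If the quotient group $\mathcal{O}_K^{+,\times}/\mathcal{O}_K^{\times 2}$ is infinite, then there exists no classical universal quadratic lattice over $K$.
   Context: An algebraic number is totally real (resp. totally positive) if all its conjugates, i.e. all roots of its minimal polynomial over $\mathbb{Q}$, are real (resp. positive real). A totally real extension of $\mathbb{Q}$ is an algebraic extension (of finite or infinite degree) all of whose elements are totally real. For an algebraic extension $K/\mathbb{Q}$, $\mathcal{O}_K$ is the ring of elements of $K$ integral over $\mathbb{Z}$, $\mathcal{O}_K^\times$ its unit group, $\mathcal{O}_K^{\times 2}$ the subgroup of squares of units, and $\mathcal{O}_K^{+,\times}$ the group of totally positive units. Let $K$ be a totally real field. An $\mathcal{O}_K$-lattice is a finitely generated $\mathcal{O}_K$-module $\Lambda\subseteq V$, where $V$ is a finite-dimensional $K$-vector space. A quadratic map on $V$ is a map $Q:V\to K$ with $Q(av)=a^2Q(v)$ for all $a\in K$, $v\in V$, such that $B_Q(v,w)=\frac12(Q(v+w)-Q(v)-Q(w))$ is bilinear. A quadratic lattice over $K$ (quadratic $\mathcal{O}_K$-lattice) is a pair $(\Lambda,Q)$ of an $\mathcal{O}_K$-lattice and the restriction of a quadratic map to $\Lambda$. It is integral if $Q(\Lambda)\subseteq\mathcal{O}_K$; an integral quadratic lattice is classical if $B_Q(v,w)\in\mathcal{O}_K$ for all $v,w\in\Lambda$, positive definite if $Q(v)$ is totally positive for every $0\neq v\in\Lambda$, and universal if it is positive definite and for every totally positive $d\in\mathcal{O}_K$ there is $v\in\Lambda$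 with $Q(v)=d$. *)

theory Defs
  imports Complex_Main "HOL-Computational_Algebra.Computational_Algebra" "HOL-Algebra.Coset"
begin

definition is_min_poly :: "rat poly \<Rightarrow> 'k::field_char_0 \<Rightarrow> bool" where
  "is_min_poly p x \<longleftrightarrow>
     lead_coeff p = 1 \<and> irreducible p \<and> poly (map_poly of_rat p) x = 0"

definition conjugates :: "'k::field_char_0 \<Rightarrow> complex set" where
  "conjugates x = {z. \<exists>p. is_min_poly p x \<and> poly (map_poly of_rat p) z = 0}"

definition totally_real :: "'k::field_char_0 \<Rightarrow> bool" where
  "totally_real x \<longleftrightarrow> algebraic x \<and> (\<forall>z\<in>conjugates x. z \<in> \<real>)"

definition totally_positive :: "'k::field_char_0 \<Rightarrow> bool" where
  "totally_positive x \<longleftrightarrow> algebraic x \<and> (\<forall>z\<in>conjugates x. z \<in> \<real> \<and> 0 < Re z)"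

text \<open>
  The field \<open>K\<close> is the whole type \<open>'k\<close>. Class \<open>field_char_0\<close> makes it an extension of
  the rationals, and \<open>totally_real\<close> includes algebraicity.
\<close>
definition totally_real_extension :: "'k::field_char_0 itself \<Rightarrow> bool" where
  "totally_real_extension _ \<longleftrightarrow> (\<forall>x::'k. totally_real x)"

definition ring_of_integers :: "'k::field_char_0 set" ("\<O>") where
  "\<O> = {x. algebraic_int x}"

definition integer_units :: "'k::field_char_0 set" where
  "integer_units = {u \<in> \<O>. \<exists>v\<in>\<O>. u * v = 1}"

definition unit_squares :: "'k::field_char_0 set" where
  "unit_squares = {u\<^sup>2 | u. u \<in> integer_units}"

definition totally_positive_units :: "'k::field_char_0 monoid" where
  "totally_positive_units =
     \<lparr>carrier = {u \<in> integer_units. totally_positive u}, mult = (*), one = 1\<rparr>"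

text \<open>
  The ambient vector space \<open>V\<close> is the whole type \<open>'v\<close> with scalar multiplication \<open>scale\<close>.
  A lattice need not span it.
\<close>
definition integer_lattice ::
    "('k::field_char_0 \<Rightarrow> 'v::ab_group_add \<Rightarrow> 'v) \<Rightarrow> 'v set \<Rightarrow> bool" where
  "integer_lattice scale L \<longleftrightarrow>
     (\<exists>S. finite S \<and> L = {\<Sum>s\<in>S. scale (c s) s | c. \<forall>s\<in>S. c s \<in> \<O>})"

definition assoc_form :: "('v::ab_group_add \<Rightarrow> 'k::field_char_0) \<Rightarrow> 'v \<Rightarrow> 'v \<Rightarrow> 'k" where
  "assoc_form Q v w = 1 / 2 * (Q (v + w) - Q v - Q w)"

definition quadratic_map ::
    "('k::field_char_0 \<Rightarrow> 'v::ab_group_add \<Rightarrow> 'v) \<Rightarrow> ('v \<Rightarrow> 'k) \<Rightarrow> bool" where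
  "quadratic_map scale Q \<longleftrightarrow>
     (\<forall>a v. Q (scale a v) = a\<^sup>2 * Q v) \<and>
     (\<forall>w. Vector_Spaces.linear scale (*) (\<lambda>v. assoc_form Q v w)) \<and>
     (\<forall>v. Vector_Spaces.linear scale (*) (\<lambda>w. assoc_form Q v w))"

text \<open>
  The form is given as a map on all of \<open>V\<close>; the notions below only use its values on \<open>L\<close>.
\<close>
definition quadratic_lattice ::
    "('k::field_char_0 \<Rightarrow> 'v::ab_group_add \<Rightarrow> 'v) \<Rightarrow> 'v set \<Rightarrow> ('v \<Rightarrow> 'k) \<Rightarrow> bool" where
  "quadratic_lattice scale L Q \<longleftrightarrow>
     (\<exists>B. finite_dimensional_vector_space scale B) \<and>
     integer_lattice scale L \<and> quadratic_map scale Q"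

definition integral_lattice ::
    "('k::field_char_0 \<Rightarrow> 'v::ab_group_add \<Rightarrow> 'v) \<Rightarrow> 'v set \<Rightarrow> ('v \<Rightarrow> 'k) \<Rightarrow> bool" where
  "integral_lattice scale L Q \<longleftrightarrow> quadratic_lattice scale L Q \<and> Q ` L \<subseteq> \<O>"

definition classical_lattice ::
    "('k::field_char_0 \<Rightarrow> 'v::ab_group_add \<Rightarrow> 'v) \<Rightarrow> 'v set \<Rightarrow> ('v \<Rightarrow> 'k) \<Rightarrow> bool" where
  "classical_lattice scale L Q \<longleftrightarrow>
     integral_lattice scale L Q \<and> (\<forall>v\<in>L. \<forall>w\<in>L. assoc_form Q v w \<in> \<O>)"

definition positive_definite_lattice ::
    "('k::field_char_0 \<Rightarrow> 'v::ab_group_add \<Rightarrow> 'v) \<Rightarrow> 'v set \<Rightarrow> ('v \<Rightarrow> 'k) \<Rightarrow> bool" where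
  "positive_definite_lattice scale L Q \<longleftrightarrow>
     integral_lattice scale L Q \<and> (\<forall>v\<in>L. v \<noteq> 0 \<longrightarrow> totally_positive (Q v))"

definition universal_lattice ::
    "('k::field_char_0 \<Rightarrow> 'v::ab_group_add \<Rightarrow> 'v) \<Rightarrow> 'v set \<Rightarrow> ('v \<Rightarrow> 'k) \<Rightarrow> bool" where
  "universal_lattice scale L Q \<longleftrightarrow>
     positive_definite_lattice scale L Q \<and>
     (\<forall>d\<in>\<O>. totally_positive d \<longrightarrow> (\<exists>v\<in>L. Q v = d))"

end

theory Submission
  imports Defs "Subresultants.Subresultant_Gcd" "Jordan_Normal_Form.Char_Poly"
    "HOL-Computational_Algebra.Field_as_Ring"
begin

text \<open>
  A universal lattice represents every totally positive unit. Let \<open>Q v\<close> and \<open>Q w\<close> be such units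
  and \<open>c = B(w, v) / Q v\<close>, an integer because the lattice is classical. Then
  \<open>Q w = Q (c v) + Q (w - c v)\<close>. A unit is never a sum of two totally positive integers, since
  dividing by it would give an integer with all conjugates strictly between \<open>0\<close> and \<open>1\<close>. So
  either \<open>c = 0\<close>, or \<open>w = c v\<close> and \<open>Q w = c\<^sup>2 Q v\<close>. Vectors representing units from distinct
  square classes are therefore orthogonal, and an infinite quotient would give an infinite
  independent set.
\<close>

section \<open>Algebraic integers form a ring\<close>

text \<open>For finite \<open>S\<close> this is the Z-submodule generated by \<open>S\<close>. For
  infinite \<open>S\<close> the sum defaults to 0 and the set is {0}, hence \<open>finite S\<close>
  in \<open>int_span_base\<close>.\<close>

definition int_span :: "'a::field_char_0 set \<Rightarrow> 'a set" where
  "int_span S = {\<Sum>s\<in>S. of_int (c s) * s | c. True}"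

lemma int_span_add:
  assumes "a \<in> int_span S" "b \<in> int_span S"
  shows "a + b \<in> int_span S"
proof -
  obtain c d where "a = (\<Sum>s\<in>S. of_int (c s) * s)" "b = (\<Sum>s\<in>S. of_int (d s) * s)"
    using assms by (auto simp: int_span_def)
  then have "a + b = (\<Sum>s\<in>S. of_int (c s + d s) * s)"
    by (simp add: sum.distrib ring_distribs)
  then show ?thesis
    unfolding int_span_def by (intro CollectI exI[of _ "\<lambda>s. c s + d s"]) simp
qed

lemma int_span_of_int_mult:
  assumes "a \<in> int_span S"
  shows "of_int k * a \<in> int_span S"
proof -
  obtain c where "a = (\<Sum>s\<in>S. of_int (c s) * s)"
    using assms by (auto simp: int_span_def)
  then have "of_int k * a = (\<Sum>s\<in>S. of_int (k * c s) * s)"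
    by (simp add: sum_distrib_left mult.assoc)
  then show ?thesis
    unfolding int_span_def by (intro CollectI exI[of _ "\<lambda>s. k * c s"]) simp
qed

lemma int_span_0: "0 \<in> int_span S"
  unfolding int_span_def by (intro CollectI exI[of _ "\<lambda>s. 0"]) simp

lemma int_span_sum:
  assumes "\<And>i. i \<in> I \<Longrightarrow> f i \<in> int_span S"
  shows "(\<Sum>i\<in>I. f i) \<in> int_span S"
  using assms by (induction I rule: infinite_finite_induct) (auto simp: int_span_0 int_span_add)

lemma int_span_base:
  assumes "finite S" "s \<in> S"
  shows "s \<in> int_span S"
proof -
  have "s = (\<Sum>t\<in>S. of_int (if t = s then 1 else 0) * t)"
    using assms by (simp add: if_distrib[of of_int] if_distrib[of "\<lambda>x. x * _"] cong: if_cong)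
  then show ?thesis
    unfolding int_span_def by (intro CollectI exI[of _ "\<lambda>t. if t = s then 1 else 0"]) simp
qed

lemma int_span_mult:
  assumes "\<And>s. s \<in> S \<Longrightarrow> x * s \<in> int_span S" "a \<in> int_span S"
  shows "x * a \<in> int_span S"
proof -
  obtain c where "a = (\<Sum>s\<in>S. of_int (c s) * s)"
    using assms by (auto simp: int_span_def)
  then have "x * a = (\<Sum>s\<in>S. of_int (c s) * (x * s))"
    by (simp add: sum_distrib_left mult_ac)
  then show ?thesis
    using assms(1) by (auto intro!: int_span_sum int_span_of_int_mult)
qed

text \<open>The determinant trick: multiplication by \<open>z\<close> on the generators is given by
  an integer matrix \<open>A\<close>. The vector of generators, nonzero by \<open>ne\<close>, is an
  eigenvector of \<open>A\<close> for \<open>z\<close>, so \<open>z\<close> is a root of the monic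
  integer polynomial \<open>char_poly A\<close>.\<close>

lemma algebraic_int_if_stabilizes_int_span:
  assumes fin: "finite S" and ne: "\<exists>s\<in>S. s \<noteq> 0"
    and stable: "\<And>s. s \<in> S \<Longrightarrow> z * s \<in> int_span S"
  shows "algebraic_int (z :: 'a::field_char_0)"
proof -
  obtain xs where xs: "set xs = S" "distinct xs"
    using fin finite_distinct_list by blast
  define n where "n = length xs"
  have "\<forall>s\<in>S. \<exists>c. z * s = (\<Sum>t\<in>S. of_int (c t) * t)"
    using stable by (auto simp: int_span_def)
  then obtain c where c: "\<And>s. s \<in> S \<Longrightarrow> z * s = (\<Sum>t\<in>S. of_int (c s t) * t)"
    by metis
  define A :: "int mat" where "A = mat n n (\<lambda>(i, j). c (xs ! i) (xs ! j))"
  define v where "v = vec n (\<lambda>i. xs ! i)"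
  have A: "A \<in> carrier_mat n n" and v: "v \<in> carrier_vec n"
    by (auto simp: A_def v_def)
  have "map_mat of_int A *\<^sub>v v = z \<cdot>\<^sub>v v"
  proof (rule eq_vecI)
    fix i assume "i < dim_vec (z \<cdot>\<^sub>v v)"
    then have i: "i < n" by (simp add: v_def)
    have "(map_mat of_int A *\<^sub>v v) $ i = (\<Sum>j<n. of_int (c (xs ! i) (xs ! j)) * xs ! j)"
      using i by (auto simp: A_def v_def scalar_prod_def atLeast0LessThan)
    also have "\<dots> = (\<Sum>t\<in>S. of_int (c (xs ! i) t) * t)"
      by (rule sum.reindex_bij_betw) (use xs bij_betw_nth n_def in blast)
    also have "\<dots> = z * xs ! i"
      using c[of "xs ! i"] i xs n_def by auto
    finally show "(map_mat of_int A *\<^sub>v v) $ i = (z \<cdot>\<^sub>v v) $ i"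
      using i by (simp add: v_def)
  qed (simp add: A_def v_def)
  moreover have "v \<noteq> 0\<^sub>v n"
  proof
    assume v0: "v = 0\<^sub>v n"
    obtain i where "i < n" "xs ! i \<noteq> 0"
      using ne xs n_def by (metis in_set_conv_nth)
    then show False
      using v0 by (metis v_def index_vec index_zero_vec(1))
  qed
  ultimately have "eigenvalue (map_mat of_int A) z"
    unfolding eigenvalue_def eigenvector_def using A v by auto
  then have "poly (char_poly (map_mat of_int A)) z = 0"
    using A by (subst eigenvalue_root_char_poly[symmetric, of _ n]) auto
  then have "poly (map_poly of_int (char_poly A)) z = 0"
    using of_int_hom.char_poly_hom[OF A] by metis
  then show ?thesis
    using degree_monic_char_poly[OF A] by (auto simp: algebraic_int_altdef_ipoly)
qed

lemma algebraic_int_power_reduction: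
  assumes "algebraic_int (x :: 'a::field_char_0)"
  obtains m and c :: "nat \<Rightarrow> int" where "m > 0" "x ^ m = (\<Sum>i<m. of_int (c i) * x ^ i)"
proof -
  obtain p :: "int poly" where p: "poly (map_poly of_int p) x = 0" "lead_coeff p = 1"
    using assms by (auto simp: algebraic_int_altdef_ipoly)
  define m where "m = degree p"
  have "0 = (\<Sum>i\<le>m. of_int (coeff p i) * x ^ i)"
    using p(1) by (simp add: poly_altdef m_def)
  also have "\<dots> = (\<Sum>i<m. of_int (coeff p i) * x ^ i) + x ^ m"
    using p(2) by (simp add: lessThan_Suc_atMost[symmetric] m_def)
  finally have "x ^ m = - (\<Sum>i<m. of_int (coeff p i) * x ^ i)"
    by (metis add.commute eq_neg_iff_add_eq_0)
  then have eq: "x ^ m = (\<Sum>i<m. of_int (- coeff p i) * x ^ i)"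
    by (simp add: sum_negf)
  \<comment> \<open>For \<open>m = 0\<close> the relation would read 1 = 0.\<close>
  have "m \<noteq> 0"
    using eq by (metis lessThan_0 power_0 sum.empty zero_neq_one)
  then show thesis
    by (intro that[OF _ eq]) simp
qed

text \<open>The ring Z[x, y] is spanned by the finitely many monomials \<open>x ^ i * y ^ j\<close>
  with \<open>i < m\<close> and \<open>j < n\<close>. Multiplication by \<open>x\<close> or
  \<open>y\<close> raises one exponent; if it reaches \<open>m\<close> or \<open>n\<close>, the
  monic relation lowers it again. Hence \<open>x + y\<close> and \<open>x * y\<close> stabilize this
  span too.\<close>

lemma algebraic_int_add_times:
  assumes "algebraic_int (x :: 'a::field_char_0)" "algebraic_int y"
  shows "algebraic_int (x + y)" "algebraic_int (x * y)"
proof -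
  obtain m c where m: "m > 0" "x ^ m = (\<Sum>i<m. of_int (c i) * x ^ i)"
    by (rule algebraic_int_power_reduction[OF assms(1)])
  obtain n d where n: "n > 0" "y ^ n = (\<Sum>i<n. of_int (d i) * y ^ i)"
    by (rule algebraic_int_power_reduction[OF assms(2)])
  define S where "S = (\<lambda>(i, j). x ^ i * y ^ j) ` ({..<m} \<times> {..<n})"
  have fin: "finite S"
    by (simp add: S_def)
  \<comment> \<open>The monomial 1 has exponents \<open>i = j = 0\<close>, which are in range
    because \<open>m\<close> and \<open>n\<close> are positive.\<close>
  have ne: "\<exists>s\<in>S. s \<noteq> 0"
    by (rule bexI[of _ 1]) (use m n in \<open>force simp: S_def\<close>)+
  have base: "x ^ i * y ^ j \<in> int_span S" if "i < m" "j < n" for i j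
    using that by (intro int_span_base[OF fin]) (auto simp: S_def)
  have xS: "x * s \<in> int_span S" if "s \<in> S" for s
  proof -
    obtain i j where s: "s = x ^ i * y ^ j" "i < m" "j < n"
      using \<open>s \<in> S\<close> by (auto simp: S_def)
    show ?thesis
    proof (cases "Suc i = m")
      case True
      then have "x * s = x ^ m * y ^ j"
        using s(1) by auto
      also have "\<dots> = (\<Sum>i<m. of_int (c i) * (x ^ i * y ^ j))"
        unfolding m(2) by (simp add: sum_distrib_right mult.assoc)
      finally show ?thesis
        using s base by (auto intro!: int_span_sum int_span_of_int_mult)
    next
      case False
      then show ?thesis
        using s base[of "Suc i" j] by (simp add: mult.assoc)
    qed
  qed
  have yS: "y * s \<in> int_span S" if "s \<in> S" for s
  proof -
    obtain i j where s: "s = x ^ i * y ^ j" "i < m" "j < n"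
      using \<open>s \<in> S\<close> by (auto simp: S_def)
    show ?thesis
    proof (cases "Suc j = n")
      case True
      then have "y * s = x ^ i * y ^ n"
        using s(1) by auto
      also have "\<dots> = (\<Sum>j<n. of_int (d j) * (x ^ i * y ^ j))"
        unfolding n(2) by (simp add: sum_distrib_left mult_ac)
      finally show ?thesis
        using s base by (auto intro!: int_span_sum int_span_of_int_mult)
    next
      case False
      then show ?thesis
        using s base[of i "Suc j"] by (simp add: mult_ac)
    qed
  qed
  show "algebraic_int (x + y)"
    using xS yS by (intro algebraic_int_if_stabilizes_int_span[OF fin ne])
      (auto simp: ring_distribs intro: int_span_add)
  show "algebraic_int (x * y)"
    using xS yS by (intro algebraic_int_if_stabilizes_int_span[OF fin ne])
      (auto simp: mult.assoc intro: int_span_mult)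
qed

lemma algebraic_int_diff:
  assumes "algebraic_int (x :: 'a::field_char_0)" "algebraic_int y"
  shows "algebraic_int (x - y)"
  using algebraic_int_add_times(1)[of x "- y"] assms by auto

lemma algebraic_int_prod_list:
  "(\<And>x. x \<in> set xs \<Longrightarrow> algebraic_int x) \<Longrightarrow> algebraic_int (prod_list xs :: 'a::field_char_0)"
  by (induction xs) (auto intro: algebraic_int_add_times)

section \<open>Conjugates and total positivity\<close>

abbreviation rat_eval :: "rat poly \<Rightarrow> 'k::field_char_0 \<Rightarrow> 'k" where
  "rat_eval p x \<equiv> poly (map_poly of_rat p) x"

lemma rat_eval_hom: "comm_ring_hom (\<lambda>p. rat_eval p (x :: 'k::field_char_0))"
proof -
  interpret map_poly_comm_ring_hom "of_rat :: rat \<Rightarrow> 'k" ..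
  show ?thesis
    by unfold_locales (simp_all add: hom_distribs)
qed

lemma rat_eval_mult: "rat_eval (p * q) x = rat_eval p x * rat_eval q (x :: 'k::field_char_0)"
proof -
  interpret comm_ring_hom "\<lambda>p. rat_eval p x" by (rule rat_eval_hom)
  show ?thesis by (rule hom_mult)
qed

lemma rat_eval_add: "rat_eval (p + q) x = rat_eval p x + rat_eval q (x :: 'k::field_char_0)"
proof -
  interpret comm_ring_hom "\<lambda>p. rat_eval p x" by (rule rat_eval_hom)
  show ?thesis by (rule hom_add)
qed

text \<open>Otherwise \<open>p\<close>, being irreducible, is coprime to \<open>q\<close>, and
  evaluating a Bezout identity at \<open>x\<close> gives 0 = 1.\<close>

lemma is_min_poly_dvd:
  fixes x :: "'k::field_char_0"
  assumes p: "is_min_poly p x" and q: "rat_eval q x = 0"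
  shows "p dvd q"
proof (rule ccontr)
  assume "\<not> p dvd q"
  moreover have "prime_elem p"
    using p by (auto simp: is_min_poly_def intro: irreducible_imp_prime_elem)
  ultimately have "Rings.coprime p q"
    by (simp add: prime_elem_imp_coprime)
  then obtain a b where "a * p + b * q = 1"
    by (metis bezout_coefficients_fst_snd coprime_imp_gcd_eq_1)
  then have "rat_eval (a * p + b * q) x = 1"
    by simp
  then show False
    using p q by (simp add: rat_eval_mult rat_eval_add is_min_poly_def)
qed

text \<open>Some prime factor of a nonzero rational polynomial vanishing at \<open>x\<close>
  vanishes at \<open>x\<close> as well.\<close>

lemma is_min_poly_exists:
  fixes x :: "'k::field_char_0"
  assumes "algebraic x"
  obtains p where "is_min_poly p x"
proof -
  obtain f :: "int poly" where f: "f \<noteq> 0" "poly (map_poly of_int f) x = 0"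
    using assms by (rule algebraicE')
  define q :: "rat poly" where "q = map_poly of_int f"
  have "q \<noteq> 0" "rat_eval q x = 0"
    using f by (simp_all add: q_def map_poly_map_poly o_def)
  then have "\<exists>p. is_min_poly p x"
  proof (induction q rule: prime_divisors_induct)
    case (unit q)
    from unit(1) obtain c where "q = monom c 0" "c \<noteq> 0"
      by (rule is_unit_polyE')
    then show ?case
      using unit.prems by (simp add: poly_monom)
  next
    case (factor p q)
    show ?case
    proof (cases "rat_eval p x = 0")
      case True
      \<comment> \<open>\<open>prime\<close> includes being normalized, which over a field means
        monic.\<close>
      have "lead_coeff p = 1"
        using unit_factor_prime[OF factor.hyps] by (simp add: unit_factor_poly_def)
      then show ?thesis
        using True factor.hyps by (auto simp: is_min_poly_def intro: prime_elem_imp_irreducible)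
    qed (use factor in \<open>auto simp: rat_eval_mult\<close>)
  qed simp
  then show thesis
    using that by blast
qed

text \<open>Two minimal polynomials of \<open>x\<close> divide each other and are monic, so they
  agree; the existential in \<open>conjugates\<close> can be replaced by any fixed
  \<open>p\<close>.\<close>

lemma totally_positive_altdef:
  fixes x :: "'k::field_char_0"
  assumes "is_min_poly p x"
  shows "totally_positive x \<longleftrightarrow> algebraic x \<and> (\<forall>z. rat_eval p z = 0 \<longrightarrow> z \<in> \<real> \<and> 0 < Re z)"
proof -
  have "q = p" if "is_min_poly q x" for q
    using that assms by (intro poly_dvd_antisym) (auto simp: is_min_poly_def intro: is_min_poly_dvd)
  then have "conjugates x = {z. rat_eval p z = 0}"
    using assms unfolding conjugates_def by blast
  then show ?thesis
    by (simp add: totally_positive_def)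
qed

text \<open>Carries rational relations from \<open>x\<close> to its conjugates in another field, in
  place of an embedding of Q(x).\<close>

lemma is_min_poly_root_if_root:
  fixes x :: "'k::field_char_0" and z :: "'l::field_char_0"
  assumes "is_min_poly p x" "rat_eval p z = 0" "rat_eval q x = 0"
  shows "rat_eval q z = 0"
proof -
  obtain r where "q = p * r"
    using is_min_poly_dvd[OF assms(1,3)] by (elim dvdE)
  then show ?thesis
    using assms(2) by (simp add: rat_eval_mult)
qed

section \<open>Resultants and common roots\<close>

text \<open>The vector of descending powers of \<open>x\<close> lies in the kernel of the Sylvester
  matrix: each row is a shifted list of coefficients, so its product with the vector is a power of
  \<open>x\<close> times \<open>poly p x\<close> or \<open>poly q x\<close>.\<close>

lemma resultant_eq_0_if_common_root:
  fixes p q :: "'a::field poly"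
  assumes "poly p x = 0" "poly q x = 0" "degree p + degree q > 0"
  shows "resultant p q = 0"
proof -
  define m n where "m = degree p" and "n = degree q"
  define v where "v = vec (m + n) (\<lambda>j. x ^ (m + n - Suc j))"
  have S: "sylvester_mat p q \<in> carrier_mat (m + n) (m + n)"
    unfolding m_def n_def by (rule sylvester_carrier_mat)
  have "sylvester_mat p q *\<^sub>v v = 0\<^sub>v (m + n)"
  proof (rule eq_vecI)
    fix i assume "i < dim_vec (0\<^sub>v (m + n) :: 'a vec)"
    then have i: "i < m + n" by simp
    have row: "(sylvester_mat p q *\<^sub>v v) $ i =
        (\<Sum>j<m + n. sylvester_mat p q $$ (i, j) * x ^ (m + n - Suc j))"
      using i by (simp add: v_def scalar_prod_def m_def n_def atLeast0LessThan)
    show "(sylvester_mat p q *\<^sub>v v) $ i = 0\<^sub>v (m + n) $ i"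
    proof (cases "i < n")
      case True
      \<comment> \<open>The first \<open>n\<close> rows hold the coefficients of \<open>p\<close> in
        descending order, in columns \<open>i\<close> to \<open>i + m\<close>; column
        \<open>j\<close> belongs to the exponent \<open>m + i - j\<close>.\<close>
      have "(\<Sum>j<m + n. sylvester_mat p q $$ (i, j) * x ^ (m + n - Suc j)) =
          (\<Sum>j\<in>{i..i + m}. coeff p (m + i - j) * x ^ (m + n - Suc j))"
        using True by (intro sum.mono_neutral_cong_right)
          (auto simp: sylvester_index_mat m_def n_def)
      also have "\<dots> = (\<Sum>k\<le>m. x ^ (n - Suc i) * (coeff p k * x ^ k))"
        using True
        by (intro sum.reindex_bij_witness[of _ "\<lambda>k. m + i - k" "\<lambda>j. m + i - j"])
          (auto simp: power_add[symmetric] ac_simps)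
      also have "\<dots> = x ^ (n - Suc i) * poly p x"
        by (simp add: poly_altdef sum_distrib_left m_def)
      finally show ?thesis
        using assms(1) i row by simp
    next
      case False
      \<comment> \<open>The remaining rows hold those of \<open>q\<close>, in columns
        \<open>i - n\<close> to \<open>i\<close>; column \<open>j\<close> belongs to the exponent
        \<open>i - j\<close>.\<close>
      have "(\<Sum>j<m + n. sylvester_mat p q $$ (i, j) * x ^ (m + n - Suc j)) =
          (\<Sum>j\<in>{i - n..i}. coeff q (i - j) * x ^ (m + n - Suc j))"
        using i False by (intro sum.mono_neutral_cong_right)
          (auto simp: sylvester_index_mat m_def n_def)
      also have "\<dots> = (\<Sum>k\<le>n. x ^ (m + n - Suc i) * (coeff q k * x ^ k))"
        using i False
        by (intro sum.reindex_bij_witness[of _ "\<lambda>k. i - k" "\<lambda>j. i - j"])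
          (auto simp: power_add[symmetric] ac_simps)
      also have "\<dots> = x ^ (m + n - Suc i) * poly q x"
        by (simp add: poly_altdef sum_distrib_left n_def)
      finally show ?thesis
        using assms(2) i row by simp
    qed
  qed (simp add: m_def n_def)
  moreover have "v \<noteq> 0\<^sub>v (m + n)"
  proof
    assume "v = 0\<^sub>v (m + n)"
    \<comment> \<open>The last entry is \<open>x ^ 0\<close>, so \<open>v\<close> is nonzero even
      for \<open>x = 0\<close>.\<close>
    moreover have "v $ (m + n - 1) = 1"
      using assms(3) by (simp add: v_def m_def n_def)
    ultimately show False
      using assms(3) by (simp add: m_def n_def)
  qed
  moreover have "v \<in> carrier_vec (m + n)"
    by (simp add: v_def)
  ultimately have "det (sylvester_mat p q) = 0"
    using det_0_iff_vec_prod_zero[OF S] by blast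
  then show ?thesis
    by (simp add: resultant_def)
qed

lemma common_root_if_resultant_eq_0:
  fixes p q :: "complex poly"
  assumes "resultant p q = 0"
  obtains w where "poly p w = 0" "poly q w = 0"
proof -
  have "degree (gcd p q) \<noteq> 0"
    using assms by (simp add: resultant_0_gcd)
  then obtain w where "poly (gcd p q) w = 0"
    using fundamental_theorem_of_algebra constant_degree by metis
  then show thesis
    using that by (meson gcd_dvd1 gcd_dvd2 poly_eq_0_iff_dvd dvd_trans)
qed

text \<open>Polynomials in X over Q[Y]: \<open>[:0, [:0, 1:]:]\<close> is Y X, so the arguments are
  p(X) and q(Y X). Setting Y to \<open>t\<close> commutes with the resultant because the degrees in
  X do not drop, which for q(t X) uses \<open>t \<noteq> 0\<close>.\<close>

lemma rat_eval_resultant: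
  fixes t :: "'l::field_char_0"
  assumes "t \<noteq> 0"
  shows "rat_eval (resultant (map_poly (\<lambda>c. [:c:]) p) (map_poly (\<lambda>c. [:c:]) q \<circ>\<^sub>p [:0, [:0, 1:]:])) t =
    resultant (map_poly of_rat p) (map_poly of_rat q \<circ>\<^sub>p [:0, t:])"
    (is "rat_eval (resultant ?F ?G) t = _")
proof -
  interpret h: comm_ring_hom "\<lambda>r. rat_eval r t"
    by (rule rat_eval_hom)
  have const: "map_poly (\<lambda>r. rat_eval r t) (map_poly (\<lambda>c. [:c:]) s) = map_poly of_rat s" for s
    by (simp add: map_poly_map_poly o_def hom_distribs)
  have G: "map_poly (\<lambda>r. rat_eval r t) ?G = map_poly of_rat q \<circ>\<^sub>p [:0, t:]"
    by (simp add: h.map_poly_pcompose const)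
  have deg: "degree (map_poly (\<lambda>c. [:c:]) s) = degree s" for s :: "rat poly"
    by (intro degree_map_poly) auto
  have degF: "degree (map_poly (\<lambda>r. rat_eval r t) ?F) = degree ?F"
    by (simp add: const deg)
  have degG: "degree (map_poly (\<lambda>r. rat_eval r t) ?G) = degree ?G"
    unfolding G using assms by (simp add: deg degree_pcompose)
  show ?thesis
    using h.resultant_map_poly[OF degF degG, unfolded const G] by (rule sym)
qed

lemma is_min_poly_degree_pos:
  fixes x :: "'k::field_char_0"
  assumes "is_min_poly p x"
  shows "degree p > 0"
proof (rule ccontr)
  assume "\<not> degree p > 0"
  then have "p = 1"
    using assms by (auto simp: is_min_poly_def elim!: degree_eq_zeroE)
  then show False
    using assms by (simp add: is_min_poly_def)
qed

text \<open>A root 0 would give p = X s with s(x) = 0, and then \<open>p\<close> would divide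
  \<open>s\<close>, which has smaller degree.\<close>

lemma is_min_poly_root_nonzero:
  fixes x :: "'k::field_char_0" and z :: "'l::field_char_0"
  assumes "is_min_poly p x" "x \<noteq> 0" "rat_eval p z = 0"
  shows "z \<noteq> 0"
proof
  assume "z = 0"
  then have "poly p 0 = 0"
    using assms(3) by simp
  then obtain s where s: "p = [:0, 1:] * s"
    by (auto simp: poly_eq_0_iff_dvd elim!: dvdE)
  then have "rat_eval p x = x * rat_eval s x"
    by (simp add: hom_distribs)
  then have "rat_eval s x = 0"
    using assms(1,2) by (simp add: is_min_poly_def)
  then have "p dvd s"
    using assms(1) by (rule is_min_poly_dvd[rotated])
  moreover have "s \<noteq> 0" "degree p = Suc (degree s)"
    using s assms(1) by (auto simp: is_min_poly_def)
  ultimately show False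
    using dvd_imp_degree_le[of p s] by simp
qed

text \<open>The rational polynomial \<open>Res\<^sub>X(p\<^sub>u(X), p\<^sub>a(Y X))\<close> vanishes at \<open>Y = y\<close>, hence at every
  conjugate of \<open>y\<close>. No embedding of the field generated by \<open>y\<close> and \<open>u\<close> has to be extended.\<close>
lemma conjugate_of_quotient:
  fixes y u :: "'k::field_char_0" and z :: complex
  assumes py: "is_min_poly py y" and pu: "is_min_poly pu u" and pa: "is_min_poly pa (y * u)"
    and "y \<noteq> 0" and z: "rat_eval py z = 0"
  obtains w where "rat_eval pu w = 0" "rat_eval pa (z * w) = 0"
proof -
  define R where "R = resultant (map_poly (\<lambda>c. [:c:]) pu)
    (map_poly (\<lambda>c. [:c:]) pa \<circ>\<^sub>p [:0, [:0, 1:]:])"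
  have "rat_eval R y = resultant (map_poly of_rat pu) (map_poly of_rat pa \<circ>\<^sub>p [:0, y:])"
    unfolding R_def by (rule rat_eval_resultant) fact
  \<comment> \<open>At Y = \<open>y\<close> both polynomials vanish at X = \<open>u\<close>, since
    \<open>pa\<close> is then evaluated at \<open>y * u\<close>.\<close>
  also have "\<dots> = 0"
    using pu pa is_min_poly_degree_pos[OF pu]
    by (intro resultant_eq_0_if_common_root[of _ u])
      (auto simp: is_min_poly_def poly_pcompose mult.commute)
  finally have "rat_eval R z = 0"
    by (rule is_min_poly_root_if_root[OF py z])
  moreover have "rat_eval R z = resultant (map_poly of_rat pu) (map_poly of_rat pa \<circ>\<^sub>p [:0, z:])"
    unfolding R_def by (rule rat_eval_resultant) (rule is_min_poly_root_nonzero[OF py \<open>y \<noteq> 0\<close> z])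
  ultimately have "resultant (map_poly of_rat pu) (map_poly of_rat pa \<circ>\<^sub>p [:0, z:]) = 0"
    by simp
  then obtain w where "rat_eval pu w = 0" "poly (map_poly of_rat pa \<circ>\<^sub>p [:0, z:]) w = 0"
    by (rule common_root_if_resultant_eq_0)
  then show thesis
    using that by (simp add: poly_pcompose mult.commute)
qed

section \<open>Totally positive quotients and integers\<close>

lemma totally_positive_nonzero:
  fixes x :: "'k::field_char_0"
  assumes "totally_positive x"
  shows "x \<noteq> 0"
proof
  assume "x = 0"
  obtain p where p: "is_min_poly p x"
    using assms is_min_poly_exists by (auto simp: totally_positive_def)
  then have "rat_eval p (0 :: complex) = 0"
    using \<open>x = 0\<close> by (simp add: is_min_poly_def)
  then have "0 < Re 0"
    using assms totally_positive_altdef[OF p] by blast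
  then show False
    by simp
qed

text \<open>Each conjugate \<open>z\<close> of \<open>a / u\<close> satisfies that
  \<open>z * w\<close> is a conjugate of \<open>a\<close> for some conjugate \<open>w\<close> of
  \<open>u\<close>. Both are positive reals, hence so is their quotient \<open>z\<close>.\<close>

lemma totally_positive_divide:
  fixes a u :: "'k::field_char_0"
  assumes a: "totally_positive a" and u: "totally_positive u" and "algebraic (a / u)"
  shows "totally_positive (a / u)"
proof -
  have nz: "a \<noteq> 0" "u \<noteq> 0"
    using a u totally_positive_nonzero by auto
  obtain py where py: "is_min_poly py (a / u)"
    using is_min_poly_exists assms(3) by blast
  obtain pa where pa: "is_min_poly pa a"
    using is_min_poly_exists a totally_positive_def by metis
  obtain pu where pu: "is_min_poly pu u"
    using is_min_poly_exists u totally_positive_def by metis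
  have "z \<in> \<real> \<and> 0 < Re z" if z: "rat_eval py z = 0" for z
  proof -
    obtain w where w: "rat_eval pu w = 0" "rat_eval pa (z * w) = 0"
      by (rule conjugate_of_quotient[OF py pu _ _ z, of pa]) (use nz pa in auto)
    have "w \<in> \<real>" "0 < Re w" "z * w \<in> \<real>" "0 < Re (z * w)"
      using w a u totally_positive_altdef[OF pa] totally_positive_altdef[OF pu] by auto
    moreover from this obtain r where "w = of_real r"
      by (elim Reals_cases)
    moreover from calculation obtain s where "z * w = of_real s"
      by (elim Reals_cases)
    ultimately have "w = of_real r" "0 < r" "z * w = of_real s" "0 < s"
      by (auto simp del: times_complex.simps)
    then have "z = of_real (s / r)" "0 < s / r"
      by (auto simp: field_simps)
    then show ?thesis
      by simp
  qed
  then show ?thesis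
    using totally_positive_altdef[OF py] assms(3) by blast
qed

lemma rat_eval_pcompose_1_minus:
  fixes t :: "'l::field_char_0"
  shows "rat_eval (q \<circ>\<^sub>p (1 - [:0, 1:])) t = rat_eval q (1 - t)"
proof -
  interpret h: comm_ring_hom "\<lambda>r. rat_eval r t"
    by (rule rat_eval_hom)
  have "rat_eval (q \<circ>\<^sub>p (1 - [:0, 1:])) t = rat_eval q (rat_eval (1 - [:0, 1:]) t)"
    by (simp only: of_rat_hom.map_poly_pcompose poly_pcompose)
  also have "rat_eval (1 - [:0, 1:]) t = 1 - t"
    unfolding h.hom_minus by simp
  finally show ?thesis .
qed

lemma norm_prod_list_less_1:
  fixes xs :: "'a::real_normed_field list"
  assumes "xs \<noteq> []" "\<And>x. x \<in> set xs \<Longrightarrow> norm x < 1"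
  shows "norm (prod_list xs) < 1"
  using assms
proof (induction xs rule: list_nonempty_induct)
  case (cons x xs)
  then have "norm x * norm (prod_list xs) < 1 * 1"
    by (intro mult_strict_mono') auto
  then show ?case
    by (simp add: norm_mult)
qed simp

text \<open>The norm of \<open>y\<close> is, up to sign, a product of conjugates of absolute value
  below 1. It is a rational algebraic integer, hence an integer, hence 0; but the conjugates of a
  nonzero element are nonzero.\<close>

lemma algebraic_int_not_totally_between_0_1:
  fixes y :: "'k::field_char_0"
  assumes int: "algebraic_int y" and y: "totally_positive y" and y': "totally_positive (1 - y)"
  shows False
proof -
  obtain p where p: "is_min_poly p y"
    using is_min_poly_exists y totally_positive_def by metis
  obtain q where q: "is_min_poly q (1 - y)"
    using is_min_poly_exists y' totally_positive_def by metis
  obtain f :: "int poly" where f: "poly (map_poly of_int f) y = 0" "lead_coeff f = 1"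
    using int by (auto simp: algebraic_int_altdef_ipoly)
  define P :: "complex poly" where "P = map_poly of_rat p"
  obtain zs where zs: "Polynomial.smult (lead_coeff P) (\<Prod>a\<leftarrow>zs. [:- a, 1:]) = P" "length zs = degree P"
    using fundamental_theorem_algebra_factorized by blast
  have P_eq: "P = (\<Prod>a\<leftarrow>zs. [:- a, 1:])"
    using zs(1) p by (simp add: P_def is_min_poly_def)
  have root: "rat_eval p z = 0" if "z \<in> set zs" for z
    using that P_eq by (auto simp: P_def[symmetric] poly_prod_list prod_list_zero_iff)
  have "norm z < 1" if "z \<in> set zs" for z
  proof -
    have z: "z \<in> \<real>" "0 < Re z"
      using root[OF that] y totally_positive_altdef[OF p] by auto
    \<comment> \<open>The polynomial q(1 - X) vanishes at \<open>y\<close>, hence at its conjugate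
      \<open>z\<close>; so \<open>1 - z\<close> is a conjugate of \<open>1 - y\<close>.\<close>
    have "rat_eval (q \<circ>\<^sub>p (1 - [:0, 1:])) y = 0"
      using q by (simp only: rat_eval_pcompose_1_minus is_min_poly_def)
    then have "rat_eval (q \<circ>\<^sub>p (1 - [:0, 1:])) z = 0"
      by (rule is_min_poly_root_if_root[OF p root[OF that]])
    then have "rat_eval q (1 - z) = 0"
      by (simp only: rat_eval_pcompose_1_minus)
    then have "0 < Re (1 - z)"
      using y' totally_positive_altdef[OF q] by blast
    then show ?thesis
      using z by (auto elim!: Reals_cases)
  qed
  \<comment> \<open>An empty product would be 1, so the strict bound needs a root.\<close>
  moreover have "zs \<noteq> []"
    using zs(2) is_min_poly_degree_pos[OF p] by (auto simp: P_def)
  ultimately have less: "norm (prod_list (map uminus zs)) < 1"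
    by (intro norm_prod_list_less_1) auto
  have "algebraic_int z" if "z \<in> set zs" for z
  proof -
    have "rat_eval (map_poly of_int f) y = 0"
      using f(1) by (simp add: map_poly_map_poly o_def)
    then have "rat_eval (map_poly of_int f) z = 0"
      by (rule is_min_poly_root_if_root[OF p root[OF that]])
    then show ?thesis
      using f(2) by (auto simp: algebraic_int_altdef_ipoly map_poly_map_poly o_def)
  qed
  then have "algebraic_int (prod_list (map uminus zs))"
    by (intro algebraic_int_prod_list) auto
  \<comment> \<open>The product of the negated roots is the constant coefficient of the monic
    \<open>P\<close>, which is rational.\<close>
  moreover have "prod_list (map uminus zs) = of_rat (poly p 0)"
  proof -
    have "of_rat (poly p 0) = poly P 0"
      by (simp add: P_def)
    also have "\<dots> = prod_list (map uminus zs)"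
      unfolding P_eq by (simp add: poly_prod_list o_def)
    finally show ?thesis
      by simp
  qed
  ultimately have "prod_list (map uminus zs) \<in> \<int>"
    by (intro rational_algebraic_int_is_int) auto
  then obtain k where k: "prod_list (map uminus zs) = of_int k"
    by (elim Ints_cases)
  then have "\<bar>k\<bar> < 1"
    using less by simp
  then have "prod_list (map uminus zs) = 0"
    using k by simp
  then have "0 \<in> set zs"
    by (auto simp: prod_list_zero_iff)
  then show False
    using is_min_poly_root_nonzero[OF p totally_positive_nonzero[OF y] root] by blast
qed

section \<open>Quadratic lattices\<close>

lemma quadratic_map_add_scale:
  assumes "quadratic_map scale Q"
  shows "Q (v + scale a w) = Q v + a\<^sup>2 * Q w + 2 * a * assoc_form Q v w"
proof -
  have "assoc_form Q v (scale a w) = a * assoc_form Q v w" "Q (scale a w) = a\<^sup>2 * Q w"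
    using assms by (auto simp: quadratic_map_def Vector_Spaces.linear_iff)
  moreover have "Q (v + scale a w) = Q v + Q (scale a w) + 2 * assoc_form Q v (scale a w)"
    by (simp add: assoc_form_def field_simps)
  ultimately show ?thesis
    by simp
qed

lemma assoc_form_self:
  assumes "quadratic_map scale Q"
  shows "assoc_form Q v v = Q v"
proof -
  have "vector_space scale"
    using assms by (auto simp: quadratic_map_def Vector_Spaces.linear_iff)
  then interpret vector_space scale .
  have "v + v = scale 2 v"
    using scale_left_distrib[of 1 1 v] by simp
  then have "Q (v + v) = 4 * Q v"
    using assms by (simp add: quadratic_map_def)
  then show ?thesis
    by (simp add: assoc_form_def)
qed

text \<open>Pairing a linear relation with one of its vectors \<open>w\<close> leaves only
  \<open>c w * Q w\<close>, and \<open>Q w\<close> is nonzero.\<close>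

lemma orthogonal_imp_independent:
  assumes Q: "quadratic_map scale Q" 
    and nz: "\<And>v. v \<in> W \<Longrightarrow> Q v \<noteq> 0"
    and orth: "\<And>v w. v \<in> W \<Longrightarrow> w \<in> W \<Longrightarrow> v \<noteq> w \<Longrightarrow> assoc_form Q v w = 0"
  shows "\<not> module.dependent scale W"
proof -
  have "vector_space scale"
    using Q by (auto simp: quadratic_map_def Vector_Spaces.linear_iff)
  then interpret vector_space scale .
  have "c w = 0" if S: "S \<subseteq> W" "finite S" "(\<Sum>v\<in>S. scale (c v) v) = 0" "w \<in> S" for S c w
  proof -
    interpret B: Vector_Spaces.linear scale "(*)" "\<lambda>v. assoc_form Q v w"
      using Q by (simp add: quadratic_map_def)
    have "0 = assoc_form Q (\<Sum>v\<in>S. scale (c v) v) w"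
      using S(3) B.zero by simp
    also have "\<dots> = (\<Sum>v\<in>S. c v * assoc_form Q v w)"
      by (simp add: B.sum B.scale)
    also have "\<dots> = (\<Sum>v\<in>S. if v = w then c v * Q v else 0)"
      using S orth by (intro sum.cong) (auto simp: assoc_form_self[OF Q])
    also have "\<dots> = c w * Q w"
      using S by simp
    finally show ?thesis
      using nz S by auto
  qed
  then show ?thesis
    unfolding independent_explicit_finite_subsets by blast
qed

lemma ring_of_integers_add: "x \<in> \<O> \<Longrightarrow> y \<in> \<O> \<Longrightarrow> x + y \<in> \<O>"
  and ring_of_integers_mult: "x \<in> \<O> \<Longrightarrow> y \<in> \<O> \<Longrightarrow> x * y \<in> \<O>"
  and ring_of_integers_uminus: "x \<in> \<O> \<Longrightarrow> - x \<in> \<O>"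
  for x y :: "'k::field_char_0"
  by (auto simp: ring_of_integers_def algebraic_int_add_times)

lemma integer_units_iff: "u \<in> integer_units \<longleftrightarrow> u \<in> \<O> \<and> inverse u \<in> \<O> \<and> u \<noteq> 0"
  for u :: "'k::field_char_0"
proof
  assume "u \<in> integer_units"
  then obtain v where "u \<in> \<O>" "v \<in> \<O>" "u * v = 1"
    by (auto simp: integer_units_def)
  moreover from this have "inverse u = v"
    by (simp add: inverse_unique)
  ultimately show "u \<in> \<O> \<and> inverse u \<in> \<O> \<and> u \<noteq> 0"
    by auto
qed (auto simp: integer_units_def intro!: bexI[of _ "inverse u"])

lemma integer_lattice_add_scale:
  fixes scale :: "'k::field_char_0 \<Rightarrow> 'v::ab_group_add \<Rightarrow> 'v"
  assumes "vector_space scale" and L: "integer_lattice scale L"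
    and "v \<in> L" "w \<in> L" "a \<in> \<O>"
  shows "v + scale a w \<in> L"
proof -
  interpret vector_space scale by fact
  obtain S where S: "L = {\<Sum>s\<in>S. scale (c s) s | c. \<forall>s\<in>S. c s \<in> \<O>}"
    using L by (auto simp: integer_lattice_def)
  obtain c d where c: "v = (\<Sum>s\<in>S. scale (c s) s)" "\<forall>s\<in>S. c s \<in> \<O>"
    and d: "w = (\<Sum>s\<in>S. scale (d s) s)" "\<forall>s\<in>S. d s \<in> \<O>"
    using assms(3,4) unfolding S by blast
  have "v + scale a w = (\<Sum>s\<in>S. scale (c s + a * d s) s)"
    by (simp add: c d scale_sum_right scale_left_distrib sum.distrib)
  moreover have "\<forall>s\<in>S. c s + a * d s \<in> \<O>"
    using c d assms(5) by (auto intro: ring_of_integers_add ring_of_integers_mult)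
  ultimately show ?thesis
    unfolding S by (intro CollectI exI[of _ "\<lambda>s. c s + a * d s"] conjI)
qed

lemma zero_in_integer_lattice:
  fixes scale :: "'k::field_char_0 \<Rightarrow> 'v::ab_group_add \<Rightarrow> 'v"
  assumes "vector_space scale" and L: "integer_lattice scale L"
  shows "0 \<in> L"
proof -
  interpret vector_space scale by fact
  obtain S where S: "L = {\<Sum>s\<in>S. scale (c s) s | c. \<forall>s\<in>S. c s \<in> \<O>}"
    using L by (auto simp: integer_lattice_def)
  show ?thesis
    unfolding S by (intro CollectI exI[of _ "\<lambda>s. 0"]) (simp add: ring_of_integers_def)
qed

lemma same_square_class_if_not_orthogonal:
  fixes scale :: "'k::field_char_0 \<Rightarrow> 'v::ab_group_add \<Rightarrow> 'v"
  assumes classical: "classical_lattice scale L Q"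
    and pos: "positive_definite_lattice scale L Q"
    and v: "v \<in> L" "Q v \<in> integer_units"
    and w: "w \<in> L" "Q w \<in> integer_units" "totally_positive (Q w)"
    and "assoc_form Q w v \<noteq> 0"
  shows "\<exists>c\<in>integer_units. Q w = c\<^sup>2 * Q v"
proof -
  have lattice: "integer_lattice scale L" and Q: "quadratic_map scale Q"
    using classical
    by (auto simp: classical_lattice_def integral_lattice_def quadratic_lattice_def)
  have "vector_space scale"
    using Q by (auto simp: quadratic_map_def Vector_Spaces.linear_iff)
  then interpret vector_space scale .
  note L_add_scale = integer_lattice_add_scale[OF \<open>vector_space scale\<close> lattice]
  have Q_scale: "Q (scale a x) = a\<^sup>2 * Q x" for a x
    using Q by (simp add: quadratic_map_def)
  have Q0: "Q 0 = 0"
    using Q_scale[of 0 0] by simp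
  \<comment> \<open>The coefficient of the orthogonal projection of \<open>w\<close> onto
    \<open>v\<close>; \<open>x\<close> below is the component orthogonal to
    \<open>v\<close>.\<close>
  define c where "c = assoc_form Q w v / Q v"
  have units: "Q v \<in> \<O>" "inverse (Q v) \<in> \<O>" "Q v \<noteq> 0" "inverse (Q w) \<in> \<O>" "Q w \<noteq> 0"
    using v(2) w(2) by (auto simp: integer_units_iff)
  have c: "c \<in> \<O>" "c \<noteq> 0"
    using classical v w units assms(8)
    by (auto simp: c_def divide_inverse classical_lattice_def intro!: ring_of_integers_mult)
  define x where "x = w + scale (- c) v"
  have "x \<in> L" "scale c v \<in> L"
    using L_add_scale[of w v "- c"] L_add_scale[of 0 v c] c v w
      zero_in_integer_lattice[OF \<open>vector_space scale\<close> lattice]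
    by (simp_all add: x_def ring_of_integers_uminus)
  have Qw: "Q w = Q x + c\<^sup>2 * Q v"
  proof -
    have "Q x = Q w + c\<^sup>2 * Q v - 2 * c * assoc_form Q w v"
      using quadratic_map_add_scale[OF Q, of w "- c" v] by (simp only: x_def) simp
    moreover have "assoc_form Q w v = c * Q v"
      using units(3) by (simp add: c_def)
    ultimately show ?thesis
      by (simp add: power2_eq_square)
  qed
  have "x = 0"
  proof (rule ccontr)
    assume "x \<noteq> 0"
    \<comment> \<open>Dividing \<open>Qw\<close> by the unit \<open>Q w\<close> splits 1 into the
      two integers \<open>y\<close> and \<open>1 - y\<close>.\<close>
    define y where "y = c\<^sup>2 * Q v / Q w"
    have "y \<in> \<O>"
      using c units
      by (auto simp: y_def divide_inverse power2_eq_square intro!: ring_of_integers_mult)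
    then have int: "algebraic_int y"
      by (simp add: ring_of_integers_def)
    have y': "1 - y = Q x / Q w"
      using Qw units(5) by (simp add: y_def field_simps)
    \<comment> \<open>Non-orthogonality enters here through \<open>c \<noteq> 0\<close>: positive
      definiteness makes both summands of \<open>Q w\<close> totally positive.\<close>
    have "scale c v \<noteq> 0"
      using Q0 Q_scale[of c v] c units by auto
    then have "totally_positive (c\<^sup>2 * Q v)" "totally_positive (Q x)"
      using pos \<open>x \<noteq> 0\<close> \<open>x \<in> L\<close> \<open>scale c v \<in> L\<close> Q_scale[of c v]
      by (auto simp: positive_definite_lattice_def)
    moreover have "algebraic y" "algebraic (1 - y)"
      using int algebraic_int_diff[of 1 y] by auto
    ultimately have "totally_positive y" "totally_positive (1 - y)"
      using w(3) totally_positive_divide unfolding y' unfolding y_def by blast+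
    then show False
      using algebraic_int_not_totally_between_0_1 int by blast
  qed
  then have eq: "Q w = c\<^sup>2 * Q v"
    using Qw Q0 by simp
  \<comment> \<open>This writes the inverse of \<open>c\<close> as a product of integers, so
    \<open>c\<close> is a unit.\<close>
  have "inverse c = c * Q v * inverse (Q w)"
    using c(2) units(3) by (simp add: eq power2_eq_square field_simps)
  then have "c \<in> integer_units"
    using c units by (auto simp: integer_units_iff intro!: ring_of_integers_mult)
  then show ?thesis
    using eq by blast
qed

section \<open>Square classes of units\<close>

lemma integer_units_mult: "u \<in> integer_units \<Longrightarrow> v \<in> integer_units \<Longrightarrow> u * v \<in> integer_units"
  and integer_units_inverse: "u \<in> integer_units \<Longrightarrow> inverse u \<in> integer_units"
  for u v :: "'k::field_char_0"
  by (auto simp: integer_units_iff intro: ring_of_integers_mult)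

text \<open>The two inclusions reindex the squared unit \<open>d\<close> as \<open>d * c\<close> and
  as \<open>d * inverse c\<close>.\<close>

lemma unit_squares_coset_eq:
  fixes c u :: "'k::field_char_0"
  assumes c: "c \<in> integer_units"
  shows "unit_squares #>\<^bsub>totally_positive_units\<^esub> (c\<^sup>2 * u) =
    unit_squares #>\<^bsub>totally_positive_units\<^esub> u"
proof -
  have coset: "unit_squares #>\<^bsub>totally_positive_units\<^esub> x = {d\<^sup>2 * x | d. d \<in> integer_units}"
    for x :: 'k
    by (auto simp: r_coset_def totally_positive_units_def unit_squares_def)
  have "\<exists>e. d\<^sup>2 * (c\<^sup>2 * u) = e\<^sup>2 * u \<and> e \<in> integer_units" if "d \<in> integer_units" for d
    using that c by (intro exI[of _ "d * c"]) (simp add: integer_units_mult power_mult_distrib)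
  moreover have "\<exists>e. d\<^sup>2 * u = e\<^sup>2 * (c\<^sup>2 * u) \<and> e \<in> integer_units"
    if "d \<in> integer_units" for d
  proof (intro exI conjI)
    have "c \<noteq> 0"
      using c by (simp add: integer_units_iff)
    then show "d\<^sup>2 * u = (d * inverse c)\<^sup>2 * (c\<^sup>2 * u)"
      by (simp add: field_simps)
    show "d * inverse c \<in> integer_units"
      using that c by (intro integer_units_mult integer_units_inverse)
  qed
  ultimately show ?thesis
    unfolding coset by blast
qed

theorem proposition1p3:
  assumes "totally_real_extension TYPE('k::field_char_0)"
    and "infinite (carrier (totally_positive_units Mod (unit_squares :: 'k set)))"
  shows "\<not> (\<exists>(scale :: 'k \<Rightarrow> 'v::ab_group_add \<Rightarrow> 'v) L Q.
            classical_lattice scale L Q \<and> universal_lattice scale L Q)"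
proof
  assume "\<exists>(scale :: 'k \<Rightarrow> 'v \<Rightarrow> 'v) L Q.
    classical_lattice scale L Q \<and> universal_lattice scale L Q"
  then obtain scale :: "'k \<Rightarrow> 'v \<Rightarrow> 'v" and L Q
    where classical: "classical_lattice scale L Q" and univ: "universal_lattice scale L Q"
    by blast
  have pos: "positive_definite_lattice scale L Q"
    using univ by (simp add: universal_lattice_def)
  obtain basis where "finite_dimensional_vector_space scale basis"
    and Q: "quadratic_map scale Q"
    using classical
    by (auto simp: classical_lattice_def integral_lattice_def quadratic_lattice_def)
  then interpret finite_dimensional_vector_space scale basis
    by simp
  define G where "G = (totally_positive_units :: 'k monoid)"
  define C where "C = rcosets\<^bsub>G\<^esub> unit_squares"
  have "infinite C"
    using assms(2) by (simp add: C_def G_def FactGroup_def)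
  \<comment> \<open>Universality provides a lattice vector for a representative of each coset;
    \<open>v\<close> then chooses one per coset.\<close>
  have "\<forall>X\<in>C. \<exists>v\<in>L. Q v \<in> carrier G \<and> X = unit_squares #>\<^bsub>G\<^esub> Q v"
  proof
    fix X assume "X \<in> C"
    then obtain u where u: "u \<in> carrier G" "X = unit_squares #>\<^bsub>G\<^esub> u"
      by (auto simp: C_def RCOSETS_def)
    then have "u \<in> \<O>" "totally_positive u"
      by (auto simp: G_def totally_positive_units_def integer_units_def)
    then obtain v where "v \<in> L" "Q v = u"
      using univ by (auto simp: universal_lattice_def)
    then show "\<exists>v\<in>L. Q v \<in> carrier G \<and> X = unit_squares #>\<^bsub>G\<^esub> Q v"
      using u by auto
  qed
  then obtain v where v: "\<And>X. X \<in> C \<Longrightarrow> v X \<in> L" "\<And>X. X \<in> C \<Longrightarrow> Q (v X) \<in> carrier G"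
    "\<And>X. X \<in> C \<Longrightarrow> X = unit_squares #>\<^bsub>G\<^esub> Q (v X)"
    by metis
  \<comment> \<open>The coset is recovered from its vector as the class of
    \<open>Q (v X)\<close>.\<close>
  have "inj_on v C"
    using v(3) by (metis inj_onI)
  then have "infinite (v ` C)"
    using \<open>infinite C\<close> finite_imageD by blast
  moreover have "independent (v ` C)"
  proof (rule orthogonal_imp_independent[OF Q])
    fix x assume "x \<in> v ` C"
    then show "Q x \<noteq> 0"
      using v(2) by (auto simp: G_def totally_positive_units_def integer_units_iff)
  next
    fix x y assume "x \<in> v ` C" "y \<in> v ` C" "x \<noteq> y"
    then obtain X Y where XY: "X \<in> C" "Y \<in> C" "x = v X" "y = v Y" "X \<noteq> Y"
      by auto
    show "assoc_form Q x y = 0"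
    proof (rule ccontr)
      assume "assoc_form Q x y \<noteq> 0"
      then have "\<exists>c\<in>integer_units. Q x = c\<^sup>2 * Q y"
        using v XY by (intro same_square_class_if_not_orthogonal[OF classical pos])
          (auto simp: G_def totally_positive_units_def)
      then have "X = Y"
        using v(3) XY unit_squares_coset_eq by (metis G_def)
      then show False
        using XY by simp
    qed
  qed
  \<comment> \<open>Independent sets in a finite-dimensional space are finite.\<close>
  ultimately show False
    using finiteI_independent by blast
qed

end
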